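(* Consider the evidence-augmented AMM with cost function $C(\boldsymbol{s};R)$ and price function $\pi(\boldsymbol{s};R)$. At any market state $(\boldsymbol{s},R)$, the marginal cost of evidence is $$\frac{\partial C}{\partial R}(\boldsymbol{s};R)=\frac{\partial\beta}{\partial R}(R)\;H\big(\pi(\boldsymbol{s};R)\big).$$ As such, for any decreasing function $\beta(R)$, the evidence cost $C(\boldsymbol{s}_{t-1};r(E^{total}_{t-1}\cup E_t))-C(\boldsymbol{s}_{t-1};R_{t-1})$ is always non-positive.
   Context: There are $n$ alternatives. $\boldsymbol{s}\in\mathbb{R}^n_{\ge0}$ is the vector of shares sold and $R\ge0$ the cumulative evidence quality. The liquidity function $\beta$ is positive and differentiable. The cost and price functions are $$C(\boldsymbol{s};R)=\beta(R)\log\sum_i\exp\!\Big(\frac{s_i}{\beta(R)}\Big),\qquad \pi_i(\boldsymbol{s};R)=\frac{\exp(s_i/\beta(R))}{\sum_j\exp(s_j/\beta(R))}.$$ $H(p)=-\sum_ip_i\log p_i$ is Shannon entropy. Evidence quality is a function $r$ on finite evidence sets with $r(E)\ge0$ and $r(E_1)\le r(E_2)$ whenever $E_1\subseteq E_2$; $E^{total}_{t-1}$ is the evidence in the market before trader $t$, $R_{t-1}=r(E^{total}_{t-1})$, $E_t$ is the evidence supplied by trader $t$, and $\boldsymbol{s}_{t-1}$ is the share vector before trader $t$. *)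

theory Defs
  imports "HOL-Analysis.Analysis"
begin

definition cost :: "(real \<Rightarrow> real) \<Rightarrow> real ^ 'n \<Rightarrow> real \<Rightarrow> real" where
  "cost \<beta> s R = \<beta> R * ln (\<Sum>i\<in>UNIV. exp (s $ i / \<beta> R))"

definition price :: "(real \<Rightarrow> real) \<Rightarrow> real ^ 'n \<Rightarrow> real \<Rightarrow> real ^ 'n" where
  "price \<beta> s R = (\<chi> i. exp (s $ i / \<beta> R) / (\<Sum>j\<in>UNIV. exp (s $ j / \<beta> R)))"

definition shannon_entropy :: "real ^ 'n \<Rightarrow> real" where
  "shannon_entropy p = - (\<Sum>i\<in>UNIV. p $ i * ln (p $ i))"

text \<open>Only the values of \<open>r\<close> on finite sets are constrained.\<close>

definition evidence_quality :: "('e set \<Rightarrow> real) \<Rightarrow> bool" where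
  "evidence_quality r \<longleftrightarrow>
     (\<forall>E. finite E \<longrightarrow> r E \<ge> 0) \<and>
     (\<forall>E\<^sub>1 E\<^sub>2. finite E\<^sub>2 \<longrightarrow> E\<^sub>1 \<subseteq> E\<^sub>2 \<longrightarrow> r E\<^sub>1 \<le> r E\<^sub>2)"

end

theory Submission
  imports Defs
begin

text \<open>
  The evidence quality enters the cost only through the liquidity \<open>b = \<beta> R\<close>, and the derivative of
  \<open>b \<mapsto> b ln (\<Sum>\<^sub>i exp (s\<^sub>i / b))\<close> on \<open>b > 0\<close> is the entropy of the price vector. The chain rule gives
  the marginal cost of evidence. Since entropy is nonnegative, the cost is nondecreasing in \<open>b\<close>, so it
  falls when evidence lowers \<open>b\<close>.
\<close>

text \<open>Choosing the identity as liquidity function turns the liquidity itself into the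
  variable, so that the calculus below is independent of \<open>\<beta>\<close>.\<close>

lemma cost_conv_liquidity: "cost \<beta> s R = cost (\<lambda>b. b) s (\<beta> R)"
  by (simp add: cost_def)

lemma price_conv_liquidity: "price \<beta> s R = price (\<lambda>b. b) s (\<beta> R)"
  by (simp add: price_def)

lemma sum_exp_pos: "(\<Sum>i\<in>UNIV. exp (f i)) > (0::real)" for f :: "'n::finite \<Rightarrow> real"
  by (rule sum_pos) auto

lemma price_pos: "price \<beta> s R $ i > 0"
  by (simp add: price_def sum_exp_pos)

lemma sum_price: "(\<Sum>i\<in>UNIV. price \<beta> s R $ i) = 1"
  using sum_exp_pos[of "\<lambda>j. s $ j / \<beta> R"]
  by (simp add: price_def flip: sum_divide_distrib)

text \<open>The logarithm of a price is \<open>s $ i / \<beta> R\<close> minus a normalizing term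
  common to all \<open>i\<close>, and the prices sum to 1. This is the form in which entropy emerges
  from differentiating the cost.\<close>

lemma shannon_entropy_price:
  "shannon_entropy (price \<beta> s R) =
    ln (\<Sum>j\<in>UNIV. exp (s $ j / \<beta> R)) - (\<Sum>i\<in>UNIV. price \<beta> s R $ i * (s $ i / \<beta> R))"
proof -
  let ?Z = "\<Sum>j\<in>UNIV. exp (s $ j / \<beta> R)"
  have "ln (price \<beta> s R $ i) = s $ i / \<beta> R - ln ?Z" for i
    using sum_exp_pos[of "\<lambda>j. s $ j / \<beta> R"] by (simp add: price_def ln_div)
  hence "shannon_entropy (price \<beta> s R) =
      (\<Sum>i\<in>UNIV. price \<beta> s R $ i) * ln ?Z - (\<Sum>i\<in>UNIV. price \<beta> s R $ i * (s $ i / \<beta> R))"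
    by (simp add: shannon_entropy_def right_diff_distrib sum_subtractf sum_distrib_right)
  thus ?thesis by (simp add: sum_price)
qed

lemma shannon_entropy_nonneg:
  assumes "\<And>i. p $ i \<ge> 0" and "(\<Sum>i\<in>UNIV. p $ i) = 1"
  shows "shannon_entropy p \<ge> 0"
proof -
  have "p $ i \<le> 1" for i
    using member_le_sum[of i UNIV "\<lambda>i. p $ i"] assms by simp
  hence "p $ i * ln (p $ i) \<le> 0" for i
    \<comment> \<open>At \<open>p $ i = 0\<close> the product is 0, in line with the convention 0
      log 0 = 0; otherwise 0 < \<open>p $ i\<close> \<le> 1 makes the logarithm nonpositive.\<close>
    using assms(1)[of i] by (cases "p $ i = 0") (auto intro!: mult_nonneg_nonpos simp: less_le)
  thus ?thesis
    by (simp add: shannon_entropy_def sum_nonpos)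
qed

lemma cost_has_derivative_liquidity:
  assumes "b > 0"
  shows "(cost (\<lambda>b. b) s has_real_derivative shannon_entropy (price (\<lambda>b. b) s b)) (at b)"
proof -
  let ?Z = "\<lambda>b. \<Sum>i\<in>UNIV. exp (s $ i / b)"
  have "((\<lambda>b. b * ln (?Z b)) has_real_derivative
      ln (?Z b) + b * ((\<Sum>i\<in>UNIV. exp (s $ i / b) * (- (s $ i) / b\<^sup>2)) / ?Z b)) (at b)"
    using assms sum_exp_pos[of "\<lambda>i. s $ i / b"]
    by (auto intro!: derivative_eq_intros simp: power2_eq_square)
  \<comment> \<open>The factor \<open>b\<close> cancels one power of \<open>b\<^sup>2\<close>, and
    dividing each exponential by \<open>?Z b\<close> leaves the price as the weight of
    \<open>s $ i / b\<close>.\<close>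
  moreover have "b * ((\<Sum>i\<in>UNIV. exp (s $ i / b) * (- (s $ i) / b\<^sup>2)) / ?Z b) =
      - (\<Sum>i\<in>UNIV. price (\<lambda>b. b) s b $ i * (s $ i / b))"
    using assms unfolding sum_divide_distrib sum_distrib_left sum_negf[symmetric]
    by (intro sum.cong) (simp_all add: price_def power2_eq_square)
  moreover have "cost (\<lambda>b. b) s = (\<lambda>b. b * ln (?Z b))"
    by (simp add: cost_def fun_eq_iff)
  ultimately show ?thesis
    by (simp add: shannon_entropy_price)
qed

text \<open>The chain rule, with an arbitrary set \<open>A\<close> so that the one-sided derivative
  at the boundary point R = 0 of \<open>{0..}\<close> is covered.\<close>

lemma cost_has_derivative_evidence:
  assumes "\<beta> R > 0" and "(\<beta> has_real_derivative D) (at R within A)"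
  shows "(cost \<beta> s has_real_derivative D * shannon_entropy (price \<beta> s R)) (at R within A)"
  using DERIV_chain2[OF cost_has_derivative_liquidity[OF assms(1)] assms(2), of s]
  by (simp add: mult.commute flip: cost_conv_liquidity price_conv_liquidity)

lemma cost_mono_liquidity:
  assumes "0 < a" and "a \<le> b"
  shows "cost (\<lambda>b. b) s a \<le> cost (\<lambda>b. b) s b"
proof (rule DERIV_nonneg_imp_nondecreasing[OF \<open>a \<le> b\<close>])
  fix x assume "a \<le> x" "x \<le> b"
  moreover have "shannon_entropy (price (\<lambda>b. b) s x) \<ge> 0"
    by (rule shannon_entropy_nonneg) (simp_all add: price_pos less_imp_le sum_price)
  ultimately show "\<exists>y. (cost (\<lambda>b. b) s has_real_derivative y) (at x) \<and> 0 \<le> y"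
    using cost_has_derivative_liquidity[of x s] \<open>0 < a\<close> by force
qed

theorem theorem4:
  fixes \<beta> \<beta>' :: "real \<Rightarrow> real" and r :: "'e set \<Rightarrow> real"
  assumes \<beta>_pos: "\<And>R. R \<ge> 0 \<Longrightarrow> \<beta> R > 0"
    and \<beta>_deriv: "\<And>R. R \<ge> 0 \<Longrightarrow> (\<beta> has_real_derivative \<beta>' R) (at R within {0..})"
    and quality: "evidence_quality r"
  shows "(\<forall>(s :: real ^ 'n) R. (\<forall>i. s $ i \<ge> 0) \<longrightarrow> R \<ge> 0 \<longrightarrow>
            (cost \<beta> s has_real_derivative \<beta>' R * shannon_entropy (price \<beta> s R))
              (at R within {0..}))
       \<and> (antimono_on {0..} \<beta> \<longrightarrow>
           (\<forall>(s :: real ^ 'n) E_total E. (\<forall>i. s $ i \<ge> 0) \<longrightarrow> finite E_total \<longrightarrow> finite E \<longrightarrow>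
              cost \<beta> s (r (E_total \<union> E)) - cost \<beta> s (r E_total) \<le> 0))"
proof (intro conjI allI impI)
  fix s :: "real ^ 'n" and R :: real
  assume "R \<ge> 0"
  thus "(cost \<beta> s has_real_derivative \<beta>' R * shannon_entropy (price \<beta> s R)) (at R within {0..})"
    by (intro cost_has_derivative_evidence \<beta>_pos \<beta>_deriv)
next
  fix s :: "real ^ 'n" and E_total E :: "'e set"
  assume anti: "antimono_on {0..} \<beta>" and fin: "finite E_total" "finite E"
  \<comment> \<open>Both qualities must lie in \<open>{0..}\<close>, where \<open>\<beta>\<close> is
    positive and decreasing; their order comes from the inclusion of \<open>E_total\<close> in the
    union.\<close>
  have nonneg: "r E_total \<ge> 0" "r (E_total \<union> E) \<ge> 0"
    and le: "r E_total \<le> r (E_total \<union> E)"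
    using quality fin by (auto simp: evidence_quality_def)
  have "\<beta> (r (E_total \<union> E)) \<le> \<beta> (r E_total)"
    using monotone_onD[OF anti _ _ le] nonneg by simp
  \<comment> \<open>The two costs share the same \<open>s\<close>, so they are compared through
    their liquidities, the smaller of which is positive.\<close>
  hence "cost \<beta> s (r (E_total \<union> E)) \<le> cost \<beta> s (r E_total)"
    using cost_mono_liquidity[OF \<beta>_pos[OF nonneg(2)]]
    unfolding cost_conv_liquidity[of \<beta>] by blast
  thus "cost \<beta> s (r (E_total \<union> E)) - cost \<beta> s (r E_total) \<le> 0"
    by simp
qed

end
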